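(* Let $n>3$ be odd, $m<n$ a positive integer with $\gcd(m,n)=\gcd(m-1,n)=1$, let $t$ be a positive divisor of $n$, and let $i,j\in\{1,\dots,t\}$ with $i\neq j$. Then the neutrosophic subloops $\langle H_i(t)\cup I\rangle$ and $\langle H_j(t)\cup I\rangle$ of $\langle L_n(m)\cup I\rangle$ satisfy $\langle H_i(t)\cup I\rangle\cap\langle H_j(t)\cup I\rangle=\{e,eI\}$.
   Context: For $n>3$ odd and $m<n$ a positive integer with $\gcd(m,n)=\gcd(m-1,n)=1$, the loop $L_n(m)$ is the set $\{e,1,2,\dots,n\}$ with operation: $e\cdot i=i\cdot e=i$ for all $i$; $i\cdot i=e$ for all $i$; and for $i,j\in\{1,\dots,n\}$, $i\neq j$, $i\cdot j$ is the element $s\in\{1,\dots,n\}$ with $s\equiv mj-(m-1)i \pmod n$. The neutrosophic loop $\langle L_n(m)\cup I\rangle$ is the set $\{e,1,\dots,n,eI,1I,\dots,nI\}$ of $2(n+1)$ distinct symbols, with the product of $L_n(m)$ on $\{e,1,\dots,n\}$ and $x\cdot(yI)=(xI)\cdot y=(xI)\cdot(yI)=(x\cdot y)I$ for $x,y\in L_n(m)$. For a positive divisor $t$ of $n$, $k=n/t$ and $1\le i\le t$, $\langle H_i(t)\cup I\rangle=\{e,i,i+t,i+2t,\dots,i+(k-1)t,\ eI,iI,(i+t)I,(i+2t)I,\dots,(i+(k-1)t)I\}$. *)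

theory Defs
  imports "HOL-Algebra.Group" "HOL-Number_Theory.Cong"
begin

text \<open>
  Loops (quasigroups with a two-sided identity) are given on the record type of
  HOL-Algebra's monoids, which supplies a carrier, a product and an identity.
\<close>

locale loop =
  fixes G (structure)
  assumes one_closed: "\<one> \<in> carrier G"
    and mult_closed: "\<lbrakk>x \<in> carrier G; y \<in> carrier G\<rbrakk> \<Longrightarrow> x \<otimes> y \<in> carrier G"
    and mult_one_left: "x \<in> carrier G \<Longrightarrow> \<one> \<otimes> x = x"
    and mult_one_right: "x \<in> carrier G \<Longrightarrow> x \<otimes> \<one> = x"
    and left_div: "\<lbrakk>a \<in> carrier G; b \<in> carrier G\<rbrakk> \<Longrightarrow> \<exists>!x. x \<in> carrier G \<and> a \<otimes> x = b"
    and right_div: "\<lbrakk>a \<in> carrier G; b \<in> carrier G\<rbrakk> \<Longrightarrow> \<exists>!y. y \<in> carrier G \<and> y \<otimes> a = b"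

definition subloop :: "'a set \<Rightarrow> ('a, 'b) monoid_scheme \<Rightarrow> bool" where
  "subloop H G \<longleftrightarrow> loop G \<and> H \<subseteq> carrier G \<and> loop (G\<lparr>carrier := H\<rparr>)"

datatype loop_elem = Neutral | Num nat

definition L_mult :: "nat \<Rightarrow> nat \<Rightarrow> loop_elem \<Rightarrow> loop_elem \<Rightarrow> loop_elem" where
  "L_mult n m x y =
     (case x of
        Neutral \<Rightarrow> y
      | Num i \<Rightarrow>
          (case y of
             Neutral \<Rightarrow> x
           | Num j \<Rightarrow>
               (if i = j then Neutral
                else Num (THE s. s \<in> {1..n} \<and>
                  [int s = int m * int j - (int m - 1) * int i] (mod int n)))))"

definition L :: "nat \<Rightarrow> nat \<Rightarrow> loop_elem monoid" where
  "L n m = \<lparr>carrier = insert Neutral (Num ` {1..n}), monoid.mult = L_mult n m, one = Neutral\<rparr>"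

text \<open>\<open>Ind x\<close> is the symbol written \<open>xI\<close>, and \<open>Plain x\<close> is \<open>x\<close> itself.\<close>

datatype 'a neutro = Plain 'a | Ind 'a

definition adjoin_I :: "'a set \<Rightarrow> 'a neutro set" where
  "adjoin_I A = Plain ` A \<union> Ind ` A"

fun neutro_mult :: "('a \<Rightarrow> 'a \<Rightarrow> 'a) \<Rightarrow> 'a neutro \<Rightarrow> 'a neutro \<Rightarrow> 'a neutro" where
  "neutro_mult f (Plain x) (Plain y) = Plain (f x y)"
| "neutro_mult f (Plain x) (Ind y) = Ind (f x y)"
| "neutro_mult f (Ind x) (Plain y) = Ind (f x y)"
| "neutro_mult f (Ind x) (Ind y) = Ind (f x y)"

definition neutrosophic :: "('a, 'b) monoid_scheme \<Rightarrow> 'a neutro monoid" where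
  "neutrosophic G =
     \<lparr>carrier = adjoin_I (carrier G), monoid.mult = neutro_mult (monoid.mult G), one = Plain (one G)\<rparr>"

text \<open>
  A neutrosophic loop is in general not a loop: an equation \<open>xI \<cdot> z = y\<close> with \<open>y\<close> free
  of \<open>I\<close> has no solution. A neutrosophic subloop of \<open>\<langle>G \<union> I\<rangle>\<close> is therefore a subset which,
  with the inherited product, is itself the neutrosophic loop \<open>\<langle>P \<union> I\<rangle>\<close> of a subloop \<open>P\<close>.
\<close>

definition neutrosophic_subloop :: "'a neutro set \<Rightarrow> ('a, 'b) monoid_scheme \<Rightarrow> bool" where
  "neutrosophic_subloop S G \<longleftrightarrow>
     S \<subseteq> carrier (neutrosophic G) \<and>
     (\<exists>P. subloop P G \<and>
        (neutrosophic G)\<lparr>carrier := S\<rparr> = neutrosophic (G\<lparr>carrier := P\<rparr>))"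

definition H_I :: "nat \<Rightarrow> nat \<Rightarrow> nat \<Rightarrow> loop_elem neutro set" where
  "H_I n t i = adjoin_I (insert Neutral {Num (i + a * t) | a. a < n div t})"

end

theory Submission
  imports Defs
begin

text \<open>
  On \<open>{1..n}\<close> the operation \<open>(i, j) \<mapsto> m j - (m - 1) i\<close> modulo \<open>n\<close> is idempotent, and it is
  cancellative on both sides because \<open>m\<close> and \<open>m - 1\<close> are units modulo \<open>n\<close>: it is a finite
  idempotent quasigroup. The loop \<open>L_n(m)\<close> arises from it by the usual adjunction of an identity
  \<open>e\<close>, with the squares redefined to be \<open>e\<close>. By idempotence the value \<open>i\<close> which the square
  \<open>i \<cdot> i\<close> gives up is exactly the one which \<open>i \<cdot> e\<close> and \<open>e \<cdot> i\<close> then take, so cancellation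
  survives, and a finite set with a closed cancellative product and an identity is a loop.

  Because \<open>m j - (m - 1) i = i + m (j - i)\<close>, the product of two numbers congruent to \<open>r\<close> modulo
  a divisor \<open>t\<close> of \<open>n\<close> is again congruent to \<open>r\<close>. The numbers in \<open>H_r(t)\<close> form such a residue
  class, so the argument above applies to \<open>H_r(t)\<close> and, with \<open>t = 1\<close>, to \<open>L_n(m)\<close> itself
  (\<open>loop_residue_class\<close>). Distinct residue classes are disjoint, which leaves only \<open>e\<close> and \<open>eI\<close>
  in the intersection.
\<close>

section \<open>Finite cancellative products\<close>

text \<open>
  On a finite carrier an injective translation is a permutation, so cancellation already yields
  the existence of both quotients.
\<close>

lemma loop_if_finite_cancel:
  fixes G (structure)
  assumes fin: "finite (carrier G)"
    and one: "\<one> \<in> carrier G"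
    and closed: "\<And>x y. \<lbrakk>x \<in> carrier G; y \<in> carrier G\<rbrakk> \<Longrightarrow> x \<otimes> y \<in> carrier G"
    and one_left: "\<And>x. x \<in> carrier G \<Longrightarrow> \<one> \<otimes> x = x"
    and one_right: "\<And>x. x \<in> carrier G \<Longrightarrow> x \<otimes> \<one> = x"
    and left_cancel: "\<And>a x y. \<lbrakk>a \<in> carrier G; x \<in> carrier G; y \<in> carrier G; a \<otimes> x = a \<otimes> y\<rbrakk> \<Longrightarrow> x = y"
    and right_cancel: "\<And>a x y. \<lbrakk>a \<in> carrier G; x \<in> carrier G; y \<in> carrier G; x \<otimes> a = y \<otimes> a\<rbrakk> \<Longrightarrow> x = y"
  shows "loop G"
proof -
  have unique_preimage: "\<exists>!x. x \<in> carrier G \<and> f x = b"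
    if "inj_on f (carrier G)" "f ` carrier G \<subseteq> carrier G" "b \<in> carrier G" for f b
  proof -
    have "f ` carrier G = carrier G"
      using endo_inj_surj[OF fin] that by blast
    then show ?thesis
      using that by (metis (no_types, lifting) imageE inj_onD)
  qed
  show ?thesis
  proof
    fix a b assume a: "a \<in> carrier G" and b: "b \<in> carrier G"
    have "inj_on (\<lambda>x. a \<otimes> x) (carrier G)" "inj_on (\<lambda>x. x \<otimes> a) (carrier G)"
      using a left_cancel right_cancel by (meson inj_onI)+
    then show "\<exists>!x. x \<in> carrier G \<and> a \<otimes> x = b"
      and "\<exists>!x. x \<in> carrier G \<and> x \<otimes> a = b"
      using unique_preimage[of "\<lambda>x. a \<otimes> x" b] unique_preimage[of "\<lambda>x. x \<otimes> a" b] a b closed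
      by blast+
  qed (use one closed one_left one_right in auto)
qed

section \<open>The idempotent quasigroup\<close>

lemma eq_if_cong_range:
  fixes x y n :: nat
  assumes "x \<in> {1..n}" "y \<in> {1..n}" "[int x = int y] (mod int n)"
  shows "x = y"
proof -
  have "int n dvd int x - int y"
    using assms(3) by (simp add: cong_iff_dvd_diff)
  moreover have "\<bar>int x - int y\<bar> < int n"
    using assms(1,2) by auto
  ultimately show ?thesis
    using dvd_imp_le_int[of "int x - int y" "int n"] by force
qed

text \<open>
  The representatives run through \<open>{1..n}\<close> and not through \<open>{0..<n}\<close>, hence the shift by one.
\<close>

definition residue_rep :: "nat \<Rightarrow> int \<Rightarrow> nat" where
  "residue_rep n z = Suc (nat ((z - 1) mod int n))"

lemma residue_rep:
  assumes "n > 0"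
  shows "residue_rep n z \<in> {1..n}" "[int (residue_rep n z) = z] (mod int n)"
proof -
  have "0 \<le> (z - 1) mod int n" "(z - 1) mod int n < int n"
    using assms by auto
  then show "residue_rep n z \<in> {1..n}"
    unfolding residue_rep_def by auto
  have "int (residue_rep n z) = (z - 1) mod int n + 1"
    using assms by (simp add: residue_rep_def)
  moreover have "[(z - 1) mod int n + 1 = (z - 1) + 1] (mod int n)"
    by (intro cong_add) auto
  ultimately show "[int (residue_rep n z) = z] (mod int n)"
    by simp
qed

definition quasi_mult :: "nat \<Rightarrow> nat \<Rightarrow> nat \<Rightarrow> nat \<Rightarrow> nat" where
  "quasi_mult n m i j = residue_rep n (int m * int j - (int m - 1) * int i)"

lemma quasi_mult:
  assumes "n > 0"
  shows "quasi_mult n m i j \<in> {1..n}"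
    "[int (quasi_mult n m i j) = int m * int j - (int m - 1) * int i] (mod int n)"
  using residue_rep[OF assms] unfolding quasi_mult_def by blast+

lemma L_mult_simps:
  assumes "n > 0"
  shows "L_mult n m Neutral y = y"
    "L_mult n m x Neutral = x"
    "L_mult n m (Num i) (Num j) = (if i = j then Neutral else Num (quasi_mult n m i j))"
proof -
  have "(THE s. s \<in> {1..n} \<and> [int s = int m * int j - (int m - 1) * int i] (mod int n))
      = quasi_mult n m i j"
  proof (rule the_equality)
    fix s assume "s \<in> {1..n} \<and> [int s = int m * int j - (int m - 1) * int i] (mod int n)"
    then show "s = quasi_mult n m i j"
      using quasi_mult[OF assms] by (meson eq_if_cong_range cong_trans cong_sym)
  qed (use quasi_mult[OF assms] in blast)
  then show "L_mult n m (Num i) (Num j) = (if i = j then Neutral else Num (quasi_mult n m i j))"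
    by (simp add: L_mult_def)
qed (auto simp: L_mult_def split: loop_elem.split)

lemma quasi_mult_idem:
  assumes "i \<in> {1..n}"
  shows "quasi_mult n m i i = i"
proof -
  have "n > 0" using assms by auto
  then show ?thesis
    using quasi_mult[of n m i i] assms by (intro eq_if_cong_range) (auto simp: algebra_simps)
qed

lemma quasi_mult_left_cancel:
  assumes "coprime m n" "x \<in> {1..n}" "y \<in> {1..n}" "quasi_mult n m a x = quasi_mult n m a y"
  shows "x = y"
proof -
  have "n > 0" using assms by auto
  then have "[int m * int x - (int m - 1) * int a = int m * int y - (int m - 1) * int a] (mod int n)"
    using quasi_mult(2)[of n m a] assms(4) by (metis cong_sym cong_trans)
  then have "[int m * int x = int m * int y] (mod int n)"
    by (simp add: cong_iff_dvd_diff)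
  then have "[int x = int y] (mod int n)"
    using assms(1) by (simp add: cong_mult_lcancel)
  then show ?thesis
    using assms eq_if_cong_range by blast
qed

lemma quasi_mult_right_cancel:
  assumes "coprime (int m - 1) (int n)" "x \<in> {1..n}" "y \<in> {1..n}"
    "quasi_mult n m x a = quasi_mult n m y a"
  shows "x = y"
proof -
  have "n > 0" using assms by auto
  then have "[int m * int a - (int m - 1) * int x = int m * int a - (int m - 1) * int y] (mod int n)"
    using quasi_mult(2)[of n m _ a] assms(4) by (metis cong_sym cong_trans)
  then have "[(int m - 1) * int y = (int m - 1) * int x] (mod int n)"
    by (simp add: cong_iff_dvd_diff)
  then have "[int y = int x] (mod int n)"
    using assms(1) by (simp add: cong_mult_lcancel)
  then show ?thesis
    using assms eq_if_cong_range cong_sym by blast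
qed

text \<open>
  Modulo \<open>t\<close> both factors may be replaced by \<open>r\<close>, where idempotence gives \<open>m r - (m - 1) r = r\<close>.
  Passing from modulus \<open>n\<close> to modulus \<open>t\<close> is where \<open>t\<close> has to divide \<open>n\<close>.
\<close>

lemma quasi_mult_cong_divisor:
  assumes "n > 0" "t dvd n" "[int i = r] (mod int t)" "[int j = r] (mod int t)"
  shows "[int (quasi_mult n m i j) = r] (mod int t)"
proof -
  have "[int (quasi_mult n m i j) = int m * int j - (int m - 1) * int i] (mod int t)"
    using quasi_mult(2)[OF assms(1)] assms(2) by (meson cong_dvd_modulus int_dvd_int_iff)
  also have "[int m * int j - (int m - 1) * int i = int m * r - (int m - 1) * r] (mod int t)"
    using assms by (intro cong_diff cong_scalar_left)
  also have "int m * r - (int m - 1) * r = r"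
    by (simp add: algebra_simps)
  finally show ?thesis .
qed

section \<open>Residue classes as subloops\<close>

definition residue_class :: "nat \<Rightarrow> nat \<Rightarrow> nat \<Rightarrow> nat set" where
  "residue_class n t r = {s \<in> {1..n}. [int s = int r] (mod int t)}"

text \<open>
  Each cancellation law is that of the quasigroup. In the mixed cases, such as
  \<open>i \<cdot> e = i \<cdot> y\<close>, reading \<open>i\<close> as the idempotent product \<open>i * i\<close> forces \<open>y = i\<close>, which is
  impossible because \<open>i \<cdot> i = e\<close> is not a number.
\<close>

lemma loop_residue_class:
  assumes "n > 0" "t dvd n" "coprime m n" "coprime (int m - 1) (int n)"
  shows "loop (L n m\<lparr>carrier := insert Neutral (Num ` residue_class n t r)\<rparr>)"
proof (rule loop_if_finite_cancel; simp only: L_def monoid.simps partial_object.simps)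
  let ?C = "insert Neutral (Num ` residue_class n t r)"
  note mult = L_mult_simps[OF assms(1)]
  have range: "s \<in> {1..n}" if "s \<in> residue_class n t r" for s
    using that by (simp add: residue_class_def)
  show "finite ?C"
    by (simp add: residue_class_def)
  show "Neutral \<in> ?C" by simp
  show "L_mult n m Neutral x = x" "L_mult n m x Neutral = x" for x
    by (simp_all add: mult)
  show "L_mult n m x y \<in> ?C" if "x \<in> ?C" "y \<in> ?C" for x y
  proof -
    have "quasi_mult n m i j \<in> residue_class n t r"
      if "i \<in> residue_class n t r" "j \<in> residue_class n t r" for i j
      using that quasi_mult(1)[OF assms(1)] quasi_mult_cong_divisor[OF assms(1,2)]
      by (simp add: residue_class_def)
    then show ?thesis
      using that by (cases x; cases y) (auto simp: mult)
  qed
  have left: "quasi_mult n m a x = quasi_mult n m a y \<longleftrightarrow> x = y"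
    if "x \<in> {1..n}" "y \<in> {1..n}" for a x y
    using that quasi_mult_left_cancel[OF assms(3)] by blast
  have right: "quasi_mult n m x a = quasi_mult n m y a \<longleftrightarrow> x = y"
    if "x \<in> {1..n}" "y \<in> {1..n}" for a x y
    using that quasi_mult_right_cancel[OF assms(4)] by blast
  have fixed: "quasi_mult n m i y = i \<longleftrightarrow> i = y" "i = quasi_mult n m i y \<longleftrightarrow> i = y"
    "quasi_mult n m y i = i \<longleftrightarrow> i = y" "i = quasi_mult n m y i \<longleftrightarrow> i = y"
    if "i \<in> {1..n}" "y \<in> {1..n}" for i y
    using left[of i y i] right[of i y i] that quasi_mult_idem[of i n m] by metis+
  show "x = y" if "a \<in> ?C" "x \<in> ?C" "y \<in> ?C" "L_mult n m a x = L_mult n m a y" for a x y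
    using that
    by (cases a; cases x; cases y) (auto simp: mult left fixed dest!: range split: if_splits)
  show "x = y" if "a \<in> ?C" "x \<in> ?C" "y \<in> ?C" "L_mult n m x a = L_mult n m y a" for a x y
    using that
    by (cases a; cases x; cases y) (auto simp: mult right fixed dest!: range split: if_splits)
qed

text \<open>
  That \<open>L_n(m)\<close> is itself a loop is the case of the single residue class modulo \<open>1\<close>.
\<close>

lemma subloop_residue_class:
  assumes "n > 0" "t dvd n" "coprime m n" "coprime (int m - 1) (int n)"
  shows "subloop (insert Neutral (Num ` residue_class n t r)) (L n m)"
proof -
  have "residue_class n 1 0 = {1..n}"
    by (auto simp: residue_class_def)
  then have "loop (L n m)"
    using loop_residue_class[of n 1 m 0] assms by (simp add: L_def)
  then show ?thesis
    using loop_residue_class[OF assms]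
    by (auto simp: subloop_def L_def residue_class_def)
qed

lemma neutrosophic_subloop_adjoin_I:
  assumes "subloop P G"
  shows "neutrosophic_subloop (adjoin_I P) G"
proof -
  have "adjoin_I P \<subseteq> carrier (neutrosophic G)"
    using assms by (auto simp: neutrosophic_def adjoin_I_def subloop_def)
  moreover have "(neutrosophic G)\<lparr>carrier := adjoin_I P\<rparr> = neutrosophic (G\<lparr>carrier := P\<rparr>)"
    by (simp add: neutrosophic_def)
  ultimately show ?thesis
    using assms unfolding neutrosophic_subloop_def by blast
qed

text \<open>
  The progression \<open>r, r + t, \<dots>, r + (n div t - 1) t\<close> stops at the last member of the class of
  \<open>r\<close> not exceeding \<open>n\<close>, because \<open>1 \<le> r \<le> t\<close>.
\<close>

lemma progression_eq_residue_class:
  assumes "t dvd n" "r \<in> {1..t}"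
  shows "{r + a * t | a. a < n div t} = residue_class n t r"
proof (intro equalityI subsetI)
  fix s assume "s \<in> {r + a * t | a. a < n div t}"
  then obtain a where s: "s = r + a * t" and a: "a < n div t" by blast
  have "s \<le> Suc a * t"
    using s assms(2) by simp
  also have "\<dots> \<le> n div t * t"
    using a by (intro mult_le_mono1) simp
  also have "\<dots> = n" using assms(1) by simp
  finally show "s \<in> residue_class n t r"
    using s assms(2) by (simp add: residue_class_def cong_iff_dvd_diff)
next
  fix s assume "s \<in> residue_class n t r"
  then have s: "s \<in> {1..n}" and cong: "[s = r] (mod t)"
    by (auto simp: residue_class_def cong_int_iff)
  \<comment> \<open>The representative \<open>r\<close> is the least positive one, but it may be \<open>t\<close> itself: hence the shift by one.\<close>
  have "(s - 1) mod t = (r - 1) mod t"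
  proof -
    have "[(s - 1) + 1 = (r - 1) + 1] (mod t)"
      using cong s assms(2) by simp
    then show ?thesis
      unfolding cong_add_rcancel_nat by (simp add: cong_def)
  qed
  then have "(s - 1) mod t = r - 1"
    using assms(2) by auto
  then have "s - 1 = (r - 1) + (s - 1) div t * t"
    by (metis add.commute div_mult_mod_eq)
  then have "s = r + (s - 1) div t * t"
    using s assms(2) by auto
  moreover have "(s - 1) div t < n div t"
    using s assms by (intro less_mult_imp_div_less) auto
  ultimately show "s \<in> {r + a * t | a. a < n div t}"
    by blast
qed

lemma residue_class_disjoint:
  assumes "i \<in> {1..t}" "j \<in> {1..t}" "i \<noteq> j"
  shows "residue_class n t i \<inter> residue_class n t j = {}"
proof -
  have "\<not> [int i = int j] (mod int t)"
    using assms eq_if_cong_range by blast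
  then show ?thesis
    unfolding residue_class_def by (blast intro: cong_trans cong_sym)
qed

theorem corollary4p1p1:
  fixes n m t i j :: nat
  assumes "n > 3" and "odd n"
    and "0 < m" and "m < n"
    and "gcd m n = 1" and "gcd (m - 1) n = 1"
    and "t > 0" and "t dvd n"
    and "i \<in> {1..t}" and "j \<in> {1..t}" and "i \<noteq> j"
  shows "neutrosophic_subloop (H_I n t i) (L n m) \<and>
         neutrosophic_subloop (H_I n t j) (L n m) \<and>
         H_I n t i \<inter> H_I n t j = {Plain Neutral, Ind Neutral}"
proof -
  have H: "H_I n t r = adjoin_I (insert Neutral (Num ` residue_class n t r))" if "r \<in> {1..t}" for r
  proof -
    have "{Num (r + a * t) | a. a < n div t} = Num ` {r + a * t | a. a < n div t}"
      by blast
    then show ?thesis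
      using progression_eq_residue_class[OF assms(8) that] by (simp add: H_I_def)
  qed
  have "coprime m n"
    using assms(5) by (simp add: coprime_iff_gcd_eq_1)
  moreover have "coprime (int m - 1) (int n)"
  proof -
    have "coprime (int (m - 1)) (int n)"
      using assms(6) by (simp add: coprime_iff_gcd_eq_1)
    then show ?thesis using assms(3) by simp
  qed
  ultimately have "neutrosophic_subloop (H_I n t r) (L n m)" if "r \<in> {1..t}" for r
    unfolding H[OF that] using assms(1,8)
    by (intro neutrosophic_subloop_adjoin_I subloop_residue_class) auto
  moreover have "H_I n t i \<inter> H_I n t j = {Plain Neutral, Ind Neutral}"
    using residue_class_disjoint[OF assms(9-11), of n]
    by (auto simp: H[OF assms(9)] H[OF assms(10)] adjoin_I_def)
  ultimately show ?thesis
    using assms(9,10) by blast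
qed

end
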